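(* Let $\psi$ be a general helix in $\mathbb{E}^3$, parameterized by arc-length $s$, with curvature $\kappa$ and with constant angle $\alpha$ between its tangent and its axis. Then the position vector of $\psi$ is computed in the natural parameter form $$ \psi(s)=\sin[\alpha]\int\left(\cos\left[\csc[\alpha]\int\kappa(s)\,ds\right],\ \sin\left[\csc[\alpha]\int\kappa(s)\,ds\right],\ \cot[\alpha]\right)ds+\mathbf{C} $$ or in the parametric form $$ \psi(\phi)=\int\frac{\sin^2[\alpha]}{\kappa(\phi)}\left(\cos[\phi],\ \sin[\phi],\ \cot[\alpha]\right)d\phi+\mathbf{C},\qquad \phi=\csc[\alpha]\int\kappa(s)\,ds. $$
   Context: $\mathbb{E}^3$ is Euclidean 3-space with its usual metric $dx_1^2+dx_2^2+dx_3^2$. A curve $\psi=\psi(s)$ is of unit speed (parameterized by arc-length, the natural parameter) if $\langle\psi'(s),\psi'(s)\rangle=1$ for all $s$. The moving frame $\{\mathbf{T},\mathbf{N},\mathbf{B}\}$ (tangent $\mathbf{T}=\psi'$, principal normal, binormal) consists of mutually orthogonal unit vectors, and the curvature $\kappa$ and torsion $\tau$ are the functions in the Frenet equations $\mathbf{T}'=\kappa\mathbf{N}$, $\mathbf{N}'=-\kappa\mathbf{T}+\tau\mathbf{B}$, $\mathbf{B}'=-\tau\mathbf{N}$, where $'=d/ds$. A general helix is a curve whose tangent makes a constant angle $\alpha$ with a fixed straight line, called its axis; here $\tau/\kappa=\cot[\alpha]$. $\kappa(\phi)$ and $\psi(\phi)$ denote $\kappa$ and $\psi$ expressed in terms of the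 parameter $\phi$, and $\mathbf{C}$ is a constant vector. *)

theory Defs
  imports "HOL-Analysis.Analysis"
begin

definition csc :: "real \<Rightarrow> real" where
  "csc x = 1 / sin x"

definition vec_angle :: "real^3 \<Rightarrow> real^3 \<Rightarrow> real" where
  "vec_angle x y = arccos (x \<bullet> y / (norm x * norm y))"

(* T, N, B, kappa, tau are the Frenet data of the unit speed curve psi on the interval I.
   At an end point of I that belongs to I the derivatives are one-sided. As usual kappa > 0, so that
   the principal normal is determined by psi, and the frame is positively oriented.
   Continuity of kappa and tau is the only smoothness required beyond the Frenet equations. *)
definition frenet_apparatus ::
  "real set \<Rightarrow> (real \<Rightarrow> real^3) \<Rightarrow> (real \<Rightarrow> real^3) \<Rightarrow> (real \<Rightarrow> real^3) \<Rightarrow> (real \<Rightarrow> real^3)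
    \<Rightarrow> (real \<Rightarrow> real) \<Rightarrow> (real \<Rightarrow> real) \<Rightarrow> bool" where
  "frenet_apparatus I \<psi> T N B \<kappa> \<tau> \<longleftrightarrow>
     continuous_on I \<kappa> \<and> continuous_on I \<tau> \<and>
     (\<forall>s\<in>I.
        norm (T s) = 1 \<and> norm (N s) = 1 \<and> T s \<bullet> N s = 0 \<and> B s = cross3 (T s) (N s) \<and>
        \<kappa> s > 0 \<and>
        (\<psi> has_vector_derivative T s) (at s within I) \<and>
        (T has_vector_derivative \<kappa> s *\<^sub>R N s) (at s within I) \<and>
        (N has_vector_derivative - \<kappa> s *\<^sub>R T s + \<tau> s *\<^sub>R B s) (at s within I) \<and>
        (B has_vector_derivative - \<tau> s *\<^sub>R N s) (at s within I))"

(* u is a direction vector of the axis. As the axis is an unoriented line, u may be replaced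
   by - u, which replaces alpha by pi - alpha. *)
definition general_helix :: "real set \<Rightarrow> (real \<Rightarrow> real^3) \<Rightarrow> real^3 \<Rightarrow> real \<Rightarrow> bool" where
  "general_helix I T u \<alpha> \<longleftrightarrow> u \<noteq> 0 \<and> (\<forall>s\<in>I. vec_angle (T s) u = \<alpha>)"

(* F is one of the functions denoted by the indefinite integral of f over the interval S. *)
definition antiderivative_on ::
  "real set \<Rightarrow> (real \<Rightarrow> 'a::real_normed_vector) \<Rightarrow> (real \<Rightarrow> 'a) \<Rightarrow> bool" where
  "antiderivative_on S f F \<longleftrightarrow> (\<forall>x\<in>S. (F has_vector_derivative f x) (at x within S))"

(* g = c * (indefinite integral of f) + C: the integral exists, and the identity holds
   for every choice of it, with a constant C depending on that choice. *)
definition equals_scaled_integral_on ::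
  "real set \<Rightarrow> (real \<Rightarrow> 'a::real_normed_vector) \<Rightarrow> real \<Rightarrow> (real \<Rightarrow> 'a) \<Rightarrow> bool" where
  "equals_scaled_integral_on S g c f \<longleftrightarrow>
     (\<exists>F. antiderivative_on S f F) \<and>
     (\<forall>F. antiderivative_on S f F \<longrightarrow> (\<exists>C. \<forall>x\<in>S. g x = c *\<^sub>R F x + C))"

end

theory Submission
  imports Defs
begin

text \<open>
  Write \<open>U\<close> for the unit vector along the axis, so that \<open>T \<bullet> U = cos \<alpha>\<close> is constant.
  Differentiating gives \<open>N \<bullet> U = 0\<close>, hence \<open>U = cos \<alpha> T + b B\<close> with
  \<open>b = \<plusminus> sin \<alpha>\<close>; differentiating once more gives \<open>\<kappa> cos \<alpha> = \<tau> b\<close>. As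
  \<open>\<kappa> > 0\<close>, this rules out \<open>b = 0\<close>, so \<open>sin \<alpha> \<noteq> 0\<close>, and
  \<open>sin \<alpha> > 0\<close> because an angle lies between \<open>0\<close> and \<open>pi\<close>. This is
  \<open>helix_axis_in_frenet_frame\<close>.

  The part of \<open>T\<close> orthogonal to the axis is \<open>sin \<alpha> V\<close> with \<open>V\<close> a unit vector. For any
  \<open>\<phi>\<close> with \<open>\<phi>' = \<kappa> / sin \<alpha>\<close> the Frenet equations become the rotation equations
  \<open>V' = \<phi>' N\<close> and \<open>N' = - \<phi>' V\<close>. Turning the pair \<open>V, N\<close> back by the angle \<open>\<phi>\<close>
  therefore produces two constant vectors \<open>E1, E2\<close>, and the matrix \<open>R\<close> with rows
  \<open>E1, E2, U\<close> is an orthogonal matrix that sends the axis to the third coordinate axis and \<open>T\<close>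
  to \<open>sin \<alpha> (cos \<phi>, sin \<phi>, cot \<alpha>)\<close>. This is \<open>helix_rotating_frame\<close>. The
  first formula follows since antiderivatives on an interval differ by constants, the second by
  the substitution \<open>t = \<phi> s\<close>.

  The determinant of \<open>R\<close> is the sign of \<open>b\<close>. If \<open>\<tau> / \<kappa> = cot \<alpha>\<close> and
  \<open>b < 0\<close>, then \<open>cos \<alpha> = 0\<close>; the curve is then planar, the angle does not distinguish
  \<open>U\<close> from \<open>- U\<close>, and replacing \<open>U\<close> by \<open>- U\<close> makes \<open>R\<close> a rotation.
\<close>

section \<open>Antiderivatives on intervals of arbitrary kind\<close>

text \<open>
  The integral from a fixed base point \<open>c\<close> works on the whole interval: near each point \<open>x\<close>
  the interval looks like a compact subinterval that contains both \<open>c\<close> and \<open>x\<close>, and there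
  the fundamental theorem of calculus applies.
\<close>

lemma antiderivative_on_interval_exists:
  fixes f :: "real \<Rightarrow> 'a::euclidean_space"
  assumes "is_interval I" and "continuous_on I f"
  shows "\<exists>F. antiderivative_on I f F"
proof (cases "I = {}")
  case False
  then obtain c where c: "c \<in> I" by blast
  have "((\<lambda>u. LBINT y=c..u. f y) has_vector_derivative f x) (at x within I)" if x: "x \<in> I" for x
  proof -
    \<comment> \<open>If x is an end point of I, any p below (q above) x will do; otherwise the compact
      subinterval must reach strictly beyond x on that side.\<close>
    obtain p where p: "p < x" "\<exists>a\<in>I. a \<le> x \<and> a \<le> c \<and> (\<forall>y\<in>I. p < y \<longrightarrow> a \<le> y)"
    proof (cases "\<exists>y\<in>I. y < x")
      case True
      then obtain y where "y \<in> I" "y < x" by blast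
      then show ?thesis using c by (intro that[of y] bexI[of _ "min y c"]) (auto simp: min_def)
    next
      case False
      then show ?thesis using x c by (intro that[of "x - 1"] bexI[of _ x]) (auto simp: not_less)
    qed
    obtain q where q: "x < q" "\<exists>b\<in>I. x \<le> b \<and> c \<le> b \<and> (\<forall>y\<in>I. y < q \<longrightarrow> y \<le> b)"
    proof (cases "\<exists>y\<in>I. x < y")
      case True
      then obtain y where "y \<in> I" "x < y" by blast
      then show ?thesis using c by (intro that[of y] bexI[of _ "max y c"]) (auto simp: max_def)
    next
      case False
      then show ?thesis using x c by (intro that[of "x + 1"] bexI[of _ x]) (auto simp: not_less)
    qed
    from p q obtain a b where ab: "a \<in> I" "a \<le> x" "a \<le> c" "\<forall>y\<in>I. p < y \<longrightarrow> a \<le> y"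
      "b \<in> I" "x \<le> b" "c \<le> b" "\<forall>y\<in>I. y < q \<longrightarrow> y \<le> b" by blast
    have sub: "{a..b} \<subseteq> I"
      using mem_is_interval_1_I[OF assms(1), of a b] ab by (meson atLeastAtMost_iff subsetI)
    have "at x within I = at x within {a..b}"
      by (rule at_within_nhd[of _ "{p<..<q}"]) (use p(1) q(1) ab sub in auto)
    moreover have "((\<lambda>u. LBINT y=c..u. f y) has_vector_derivative f x) (at x within {a..b})"
      by (rule interval_integral_FTC2) (use ab sub assms(2) in \<open>auto intro: continuous_on_subset\<close>)
    ultimately show ?thesis by simp
  qed
  then show ?thesis unfolding antiderivative_on_def by blast
qed (simp add: antiderivative_on_def)

lemma has_vector_derivative_zero_constant:
  fixes f :: "real \<Rightarrow> 'a::real_normed_vector"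
  assumes "convex S" and "\<And>x. x \<in> S \<Longrightarrow> (f has_vector_derivative 0) (at x within S)"
  shows "\<exists>c. \<forall>x\<in>S. f x = c"
  using has_derivative_zero_constant[OF assms(1), of f] assms(2)
  by (simp add: has_vector_derivative_def)

text \<open>
  The scaling factor must not vanish: the existence of an antiderivative of \<open>f\<close> is obtained
  by dividing \<open>g\<close> by \<open>c\<close>.
\<close>

lemma equals_scaled_integral_onI:
  fixes f g :: "real \<Rightarrow> 'a::real_normed_vector"
  assumes "convex S" and "c \<noteq> 0"
    and g: "\<And>x. x \<in> S \<Longrightarrow> (g has_vector_derivative c *\<^sub>R f x) (at x within S)"
  shows "equals_scaled_integral_on S g c f"
  unfolding equals_scaled_integral_on_def
proof (intro conjI allI impI)
  have "((\<lambda>x. (1/c) *\<^sub>R g x) has_vector_derivative f x) (at x within S)" if "x \<in> S" for x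
    by (rule has_vector_derivative_eq_rhs,
        rule bounded_linear.has_vector_derivative[OF bounded_linear_scaleR_right], rule g[OF that])
       (use assms(2) in simp)
  then show "\<exists>F. antiderivative_on S f F" unfolding antiderivative_on_def by blast
next
  fix F assume F: "antiderivative_on S f F"
  have "((\<lambda>x. g x - c *\<^sub>R F x) has_vector_derivative 0) (at x within S)" if "x \<in> S" for x
    by (rule has_vector_derivative_eq_rhs, rule has_vector_derivative_diff[OF g[OF that]],
        rule bounded_linear.has_vector_derivative[OF bounded_linear_scaleR_right])
       (use F that in \<open>auto simp: antiderivative_on_def\<close>)
  from has_vector_derivative_zero_constant[OF assms(1) this]
  obtain C where "\<forall>x\<in>S. g x - c *\<^sub>R F x = C" by blast
  then show "\<exists>C. \<forall>x\<in>S. g x = c *\<^sub>R F x + C"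
    by (intro exI[of _ C]) (auto simp: algebra_simps)
qed

section \<open>Change of parameter\<close>

lemma inj_on_pos_derivative:
  fixes f :: "real \<Rightarrow> real"
  assumes "is_interval I"
    and f: "\<And>x. x \<in> I \<Longrightarrow> (f has_vector_derivative f' x) (at x within I)"
    and pos: "\<And>x. x \<in> I \<Longrightarrow> f' x > 0"
  shows "inj_on f I"
proof (rule linorder_inj_onI')
  fix a b assume ab: "a \<in> I" "b \<in> I" "a < b"
  have sub: "{a..b} \<subseteq> I"
    using mem_is_interval_1_I[OF assms(1), of a b] ab by (meson atLeastAtMost_iff subsetI)
  have "\<exists>x\<in>{a<..<b}. f b - f a = (\<lambda>h. h *\<^sub>R f' x) (b - a)"
    by (rule mvt_simple[OF \<open>a < b\<close>])
       (use f sub in \<open>auto simp: has_vector_derivative_def intro!: has_derivative_subset[OF _ sub]\<close>)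
  then obtain x where x: "x \<in> {a<..<b}" "f b - f a = (b - a) * f' x" by auto
  then have "f b - f a > 0" using pos[of x] sub ab by (simp add: subset_iff)
  then show "f a \<noteq> f b" by simp
qed

text \<open>
  The rule for the derivative of an inverse asks for continuity of the inverse. It comes from the
  fact that an injective continuous real function on an interval is a homeomorphism onto its
  image, which also covers one-sided derivatives at end points.
\<close>

lemma has_vector_derivative_inv_into:
  fixes f :: "real \<Rightarrow> real"
  assumes "is_interval I" and inj: "inj_on f I"
    and f: "\<And>x. x \<in> I \<Longrightarrow> (f has_vector_derivative f' x) (at x within I)"
    and x: "x \<in> I" and "f' x \<noteq> 0"
  shows "(inv_into I f has_vector_derivative inverse (f' x)) (at (f x) within f ` I)"
proof -
  have "continuous_on I f"
    using f has_vector_derivative_continuous continuous_on_eq_continuous_within by blast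
  moreover have "path_connected I"
    using assms(1) is_interval_path_connected by blast
  ultimately obtain g where g: "homeomorphism I (f ` I) f g"
    using homeomorphism_into_1d[of I f "f ` I"] inj by blast
  have "continuous_on (f ` I) (inv_into I f)"
    using homeomorphism_cont2[OF g]
    by (rule continuous_on_eq) (use g inj in \<open>auto simp: homeomorphism_def\<close>)
  then have "continuous (at (f x) within f ` I) (inv_into I f)"
    using x continuous_on_eq_continuous_within by blast
  then show ?thesis
    unfolding has_vector_derivative_def
    by (intro has_derivative_inverse_within[OF f[OF x, unfolded has_vector_derivative_def]])
       (use x inj \<open>f' x \<noteq> 0\<close> in \<open>auto simp: fun_eq_iff linear_iff algebra_simps\<close>)
qed

section \<open>The axis of a helix in the Frenet frame\<close>

text \<open>
  The difference of the two sides is orthogonal to \<open>t\<close>, \<open>n\<close> and \<open>t \<times> n\<close>. By the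
  double cross product formula it is then also parallel to \<open>t \<times> n\<close>, so it vanishes.
\<close>

lemma orthonormal_cross3_expansion:
  fixes t n x :: "real^3"
  assumes "norm t = 1" "norm n = 1" "t \<bullet> n = 0"
  shows "x = (t \<bullet> x) *\<^sub>R t + (n \<bullet> x) *\<^sub>R n + (cross3 t n \<bullet> x) *\<^sub>R cross3 t n"
proof -
  let ?b = "cross3 t n"
  have b1: "?b \<bullet> ?b = 1"
    using norm_cross_dot[of t n] assms by (simp add: power2_norm_eq_inner)
  have t1: "t \<bullet> t = 1" "n \<bullet> n = 1" using assms by (simp_all add: norm_eq_1)
  have nt: "n \<bullet> t = 0" using assms(3) by (simp add: inner_commute)
  define y where "y = x - ((t \<bullet> x) *\<^sub>R t + (n \<bullet> x) *\<^sub>R n + (?b \<bullet> x) *\<^sub>R ?b)"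
  have "t \<bullet> y = 0" "n \<bullet> y = 0" "?b \<bullet> y = 0"
    using t1 b1 assms(3) nt
    by (simp_all add: y_def inner_diff_right inner_add_right dot_cross_self)
  moreover from this have "cross3 ?b y = 0"
    by (subst cross_skew) (simp add: Lagrange inner_commute[of y])
  ultimately have "?b = 0 \<or> y = 0" using norm_and_cross_eq_0 by blast
  with b1 have "y = 0" by auto
  then show ?thesis by (simp add: y_def)
qed


text \<open>
  Differentiating the constant \<open>T \<bullet> U\<close> shows that \<open>U\<close> has no normal component, and
  differentiating \<open>N \<bullet> U = 0\<close> gives the relation between \<open>\<kappa>\<close> and \<open>\<tau>\<close>. If
  \<open>sin \<alpha>\<close> vanished, so would the binormal component, and then \<open>\<kappa> cos \<alpha> = 0\<close> would
  force \<open>cos \<alpha> = 0\<close> as well.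
\<close>

lemma helix_axis_in_frenet_frame:
  assumes "is_interval I" and ab: "\<exists>a\<in>I. \<exists>b\<in>I. a < b"
    and fr: "frenet_apparatus I \<psi> T N B \<kappa> \<tau>"
    and U: "norm U = 1" and TU: "\<And>s. s \<in> I \<Longrightarrow> T s \<bullet> U = cos \<alpha>"
    and s: "s \<in> I"
  shows "N s \<bullet> U = 0" and "\<kappa> s * cos \<alpha> = \<tau> s * (B s \<bullet> U)"
    and "U = cos \<alpha> *\<^sub>R T s + (B s \<bullet> U) *\<^sub>R B s"
    and "(B s \<bullet> U)\<^sup>2 = (sin \<alpha>)\<^sup>2" and "sin \<alpha> \<noteq> 0"
proof -
  have F: "norm (T s) = 1" "norm (N s) = 1" "T s \<bullet> N s = 0" "B s = cross3 (T s) (N s)" "\<kappa> s > 0"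
    "(T has_vector_derivative \<kappa> s *\<^sub>R N s) (at s within I)"
    "(N has_vector_derivative - \<kappa> s *\<^sub>R T s + \<tau> s *\<^sub>R B s) (at s within I)"
    if "s \<in> I" for s
    using fr that unfolding frenet_apparatus_def by auto
  have "connected I" using assms(1) is_interval_connected by blast
  \<comment> \<open>Derivatives within I are unique only because I has no isolated points.\<close>
  then have nb: "at s within I \<noteq> bot" if "s \<in> I" for s
    using connected_imp_perfect[of I s] that ab by (auto simp: trivial_limit_within)
  have der0: "d = 0" if "s \<in> I" and "(f has_vector_derivative d) (at s within I)"
      and "\<And>x. x \<in> I \<Longrightarrow> f x = c" for s d c and f :: "real \<Rightarrow> real"
  proof (rule vector_derivative_unique_within[OF nb[OF that(1)] that(2)])
    have "((\<lambda>x. c) has_vector_derivative 0) (at s within I)" by simp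
    then show "(f has_vector_derivative 0) (at s within I)"
      using that by (metis has_vector_derivative_transform)
  qed
  have inn: "((\<lambda>x. f x \<bullet> U) has_vector_derivative d \<bullet> U) (at s within I)"
    if "(f has_vector_derivative d) (at s within I)" for f :: "real \<Rightarrow> real^3" and d s
    using bounded_linear.has_vector_derivative[OF bounded_linear_inner_left that] .
  have NU: "N s \<bullet> U = 0" if "s \<in> I" for s
    using der0[OF that inn[OF F(6)[OF that]] TU] F(5)[OF that] by simp
  show "N s \<bullet> U = 0" by (rule NU[OF s])
  show kt: "\<kappa> s * cos \<alpha> = \<tau> s * (B s \<bullet> U)"
    using der0[OF s inn[OF F(7)[OF s]] NU] TU[OF s] by (simp add: inner_add_left inner_diff_left)
  show Uexp: "U = cos \<alpha> *\<^sub>R T s + (B s \<bullet> U) *\<^sub>R B s"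
    using orthonormal_cross3_expansion[OF F(1,2,3)[OF s], of U] NU[OF s] TU[OF s] F(4)[OF s]
    by simp
  have "1 = U \<bullet> U" using U by (simp add: norm_eq_1)
  also have "\<dots> = (cos \<alpha> *\<^sub>R T s + (B s \<bullet> U) *\<^sub>R B s) \<bullet> U" using Uexp by metis
  also have "\<dots> = (cos \<alpha>)\<^sup>2 + (B s \<bullet> U)\<^sup>2"
    using TU[OF s] by (simp add: inner_add_left power2_eq_square)
  finally show b: "(B s \<bullet> U)\<^sup>2 = (sin \<alpha>)\<^sup>2"
    using sin_cos_squared_add[of \<alpha>] by linarith
  show "sin \<alpha> \<noteq> 0"
  proof
    assume "sin \<alpha> = 0"
    with b kt F(5)[OF s] have "cos \<alpha> = 0" by auto
    with \<open>sin \<alpha> = 0\<close> show False using sin_cos_squared_add[of \<alpha>] by simp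
  qed
qed

section \<open>The frame rotating about the axis\<close>

text \<open>
  The vectors \<open>V\<close> and \<open>N\<close> span the plane orthogonal to \<open>U\<close> and rotate in it with
  angular velocity \<open>\<kappa> / sin \<alpha>\<close>, so they are constant when seen from a frame that
  rotates along with the angle \<open>\<phi>\<close>. The determinant is recorded because it decides
  whether \<open>R\<close> preserves orientation: it equals \<open>(V \<times> N) \<bullet> U\<close>, and
  \<open>sin \<alpha> V \<times> N\<close> differs from \<open>B = T \<times> N\<close> by a multiple of \<open>U \<times> N\<close>,
  which is orthogonal to \<open>U\<close>.
\<close>

lemma helix_rotating_frame:
  fixes T N B :: "real \<Rightarrow> real^3"
  assumes I: "is_interval I" and ab: "\<exists>a\<in>I. \<exists>b\<in>I. a < b"
    and fr: "frenet_apparatus I \<psi> T N B \<kappa> \<tau>"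
    and U: "norm U = 1" and TU: "\<And>s. s \<in> I \<Longrightarrow> T s \<bullet> U = cos \<alpha>"
    and \<phi>: "\<And>s. s \<in> I \<Longrightarrow> (\<phi> has_vector_derivative \<kappa> s / sin \<alpha>) (at s within I)"
  obtains R :: "real^3^3" where "orthogonal_matrix R" and "R *v U = axis 3 1"
    and "\<And>s. s \<in> I \<Longrightarrow> det R * sin \<alpha> = B s \<bullet> U"
    and "\<And>s. s \<in> I \<Longrightarrow> R *v T s = sin \<alpha> *\<^sub>R vector [cos (\<phi> s), sin (\<phi> s), cot \<alpha>]"
proof -
  have F: "norm (T s) = 1" "norm (N s) = 1" "T s \<bullet> N s = 0" "B s = cross3 (T s) (N s)" "\<kappa> s > 0"
    "(T has_vector_derivative \<kappa> s *\<^sub>R N s) (at s within I)"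
    "(N has_vector_derivative - \<kappa> s *\<^sub>R T s + \<tau> s *\<^sub>R B s) (at s within I)"
    if "s \<in> I" for s
    using fr that unfolding frenet_apparatus_def by auto
  note ax = helix_axis_in_frenet_frame[OF I ab fr U TU]
  obtain s0 where s0: "s0 \<in> I" using ab by blast
  have sin_nz: "sin \<alpha> \<noteq> 0" using ax(5)[OF _ s0] by blast
  define V where "V s = (1 / sin \<alpha>) *\<^sub>R (T s - cos \<alpha> *\<^sub>R U)" for s
  have TV: "T s = sin \<alpha> *\<^sub>R V s + cos \<alpha> *\<^sub>R U" for s
    using sin_nz by (simp add: V_def)
  have UU: "U \<bullet> U = 1" using U by (simp add: norm_eq_1)
  have orth: "V s \<bullet> V s = 1" "V s \<bullet> U = 0" "V s \<bullet> N s = 0" "N s \<bullet> V s = 0" "N s \<bullet> U = 0"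
     "U \<bullet> V s = 0" "U \<bullet> N s = 0" "N s \<bullet> N s = 1" if s: "s \<in> I" for s
  proof -
    have TT: "T s \<bullet> T s = 1" and NN: "N s \<bullet> N s = 1" using F[OF s] by (simp_all add: norm_eq_1)
    have NU: "N s \<bullet> U = 0" using ax(1)[OF _ s] by blast
    show "N s \<bullet> U = 0" "U \<bullet> N s = 0" using NU by (simp_all add: inner_commute)
    show "N s \<bullet> N s = 1" by (rule NN)
    have TU': "T s \<bullet> U = cos \<alpha>" "U \<bullet> T s = cos \<alpha>" using TU[OF s] by (simp_all add: inner_commute)
    have "(T s - cos \<alpha> *\<^sub>R U) \<bullet> (T s - cos \<alpha> *\<^sub>R U) = (sin \<alpha>)\<^sup>2"
      using TT UU TU'
      using sin_cos_squared_add[of \<alpha>]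
      by (simp add: inner_diff_left inner_diff_right power2_eq_square)
    then show "V s \<bullet> V s = 1"
      using sin_nz by (simp add: V_def power2_eq_square)
    show "V s \<bullet> U = 0" using TU' UU by (simp add: V_def inner_diff_left)
    then show "U \<bullet> V s = 0" by (simp add: inner_commute)
    have "U \<bullet> N s = 0" using NU by (simp add: inner_commute)
    then show "V s \<bullet> N s = 0" using F(3)[OF s] by (simp add: V_def inner_diff_left)
    then show "N s \<bullet> V s = 0" by (simp add: inner_commute)
  qed
  have dV: "(V has_vector_derivative (\<kappa> s / sin \<alpha>) *\<^sub>R N s) (at s within I)" if s: "s \<in> I" for s
    unfolding V_def
    by (auto intro!: derivative_eq_intros F(6)[OF s])
  have dN: "(N has_vector_derivative - (\<kappa> s / sin \<alpha>) *\<^sub>R V s) (at s within I)" if s: "s \<in> I" for s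
  proof -
    \<comment> \<open>Inserting the expansion of U turns the part of T orthogonal to U into a combination of
      T and B, which matches the Frenet equation for N.\<close>
    define b where "b = B s \<bullet> U"
    have b: "b\<^sup>2 = (sin \<alpha>)\<^sup>2" "\<kappa> s * cos \<alpha> = \<tau> s * b" "U = cos \<alpha> *\<^sub>R T s + b *\<^sub>R B s" "b \<noteq> 0"
      using ax(2-5)[OF _ s] unfolding b_def by force+
    have "T s - cos \<alpha> *\<^sub>R U = (1 - (cos \<alpha>)\<^sup>2) *\<^sub>R T s - (cos \<alpha> * b) *\<^sub>R B s"
      by (subst b(3)) (simp add: algebra_simps power2_eq_square)
    also have "\<dots> = b\<^sup>2 *\<^sub>R T s - (cos \<alpha> * b) *\<^sub>R B s"
      using b(1) by (simp add: sin_squared_eq)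
    finally have "- (\<kappa> s / sin \<alpha>) *\<^sub>R V s
        = - (\<kappa> s / (sin \<alpha>)\<^sup>2) *\<^sub>R (b\<^sup>2 *\<^sub>R T s - (cos \<alpha> * b) *\<^sub>R B s)"
      by (simp add: V_def power2_eq_square)
    also have "\<dots> = - \<kappa> s *\<^sub>R T s + (\<kappa> s * cos \<alpha> / b) *\<^sub>R B s"
      unfolding b(1)[symmetric] using b(4) by (simp add: algebra_simps power2_eq_square)
    also have "\<dots> = - \<kappa> s *\<^sub>R T s + \<tau> s *\<^sub>R B s"
      using b(2,4) by simp
    finally show ?thesis using F(7)[OF s] by simp
  qed
  have dcos: "((\<lambda>s. cos (\<phi> s)) has_vector_derivative - (\<kappa> s / sin \<alpha>) * sin (\<phi> s)) (at s within I)"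
   and dsin: "((\<lambda>s. sin (\<phi> s)) has_vector_derivative (\<kappa> s / sin \<alpha>) * cos (\<phi> s)) (at s within I)"
    if s: "s \<in> I" for s
    using \<phi>[OF s] unfolding has_real_derivative_iff_has_vector_derivative[symmetric]
    by (auto intro!: derivative_eq_intros)
  have conv: "convex I" using I by (simp add: is_interval_convex)
  have "((\<lambda>s. cos (\<phi> s) *\<^sub>R V s - sin (\<phi> s) *\<^sub>R N s) has_vector_derivative 0) (at s within I)"
    if s: "s \<in> I" for s
    by (rule has_vector_derivative_eq_rhs, rule has_vector_derivative_diff;
        (rule bounded_bilinear.has_vector_derivative[OF bounded_bilinear_scaleR],
          rule dcos[OF s] dsin[OF s], rule dV[OF s] dN[OF s])?)
       (simp add: algebra_simps)
  from has_vector_derivative_zero_constant[OF conv this]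
  obtain E1 where E1: "\<And>s. s \<in> I \<Longrightarrow> E1 = cos (\<phi> s) *\<^sub>R V s - sin (\<phi> s) *\<^sub>R N s" by metis
  have "((\<lambda>s. sin (\<phi> s) *\<^sub>R V s + cos (\<phi> s) *\<^sub>R N s) has_vector_derivative 0) (at s within I)"
    if s: "s \<in> I" for s
    by (rule has_vector_derivative_eq_rhs, rule has_vector_derivative_add;
        (rule bounded_bilinear.has_vector_derivative[OF bounded_bilinear_scaleR],
          rule dcos[OF s] dsin[OF s], rule dV[OF s] dN[OF s])?)
       (simp add: algebra_simps)
  from has_vector_derivative_zero_constant[OF conv this]
  obtain E2 where E2: "\<And>s. s \<in> I \<Longrightarrow> E2 = sin (\<phi> s) *\<^sub>R V s + cos (\<phi> s) *\<^sub>R N s" by metis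
  have cs: "cos x * cos x + sin x * sin x = 1" "sin x * sin x + cos x * cos x = 1" for x :: real
    using sin_cos_squared_add[of x] by (simp_all add: power2_eq_square)
  have E: "E1 \<bullet> E1 = 1" "E2 \<bullet> E2 = 1" "E1 \<bullet> E2 = 0" "E1 \<bullet> U = 0" "E2 \<bullet> U = 0"
    unfolding E1[OF s0] E2[OF s0]
    by (simp_all add: inner_diff_left inner_diff_right inner_add_left inner_add_right orth[OF s0] cs)
  let ?R = "vector [E1, E2, U] :: real^3^3"
  have Rv: "?R *v x = vector [E1 \<bullet> x, E2 \<bullet> x, U \<bullet> x]" for x
    by (simp add: vec_eq_iff forall_3 matrix_vector_mul_component)
  show ?thesis
  proof (rule that[of ?R])
    show "orthogonal_matrix ?R"
      unfolding orthogonal_matrix_orthonormal_rows forall_3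
      using E UU by (simp add: row_def orthogonal_def norm_eq_1 inner_commute vec_lambda_eta)
    show "?R *v U = axis 3 1"
      unfolding Rv using E UU by (simp add: vec_eq_iff forall_3 axis_def)
    show "?R *v T s = sin \<alpha> *\<^sub>R vector [cos (\<phi> s), sin (\<phi> s), cot \<alpha>]" if s: "s \<in> I" for s
    proof -
      have "E1 \<bullet> T s = sin \<alpha> * cos (\<phi> s)" "E2 \<bullet> T s = sin \<alpha> * sin (\<phi> s)" "U \<bullet> T s = cos \<alpha>"
        unfolding TV using E UU orth[OF s]
        by (simp_all add: inner_add_left inner_add_right inner_diff_left E1[OF s] E2[OF s])
      then show ?thesis
        unfolding Rv using sin_nz by (simp add: vec_eq_iff forall_3 cot_def)
    qed
    show "det ?R * sin \<alpha> = B s \<bullet> U" if s: "s \<in> I" for s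
    proof -
      have "det ?R = cross3 E1 E2 \<bullet> U"
        by (metis dot_cross_det cross_triple inner_commute)
      also have "cross3 E1 E2 = (cos (\<phi> s) * cos (\<phi> s) + sin (\<phi> s) * sin (\<phi> s)) *\<^sub>R cross3 (V s) (N s)"
        unfolding E1[OF s] E2[OF s] cross_add_right Cross3.left_diff_distrib cross_mult_left cross_mult_right
        by (simp add: cross_skew[of "N s" "V s"] algebra_simps) (simp add: cs flip: scaleR_add_left)
      finally have "det ?R * sin \<alpha> = cross3 (sin \<alpha> *\<^sub>R V s) (N s) \<bullet> U"
        by (simp add: cs cross_mult_left)
      also have "\<dots> = cross3 (T s) (N s) \<bullet> U"
        unfolding TV by (simp add: cross_add_left cross_mult_left inner_add_left dot_cross_self)
      finally show ?thesis by (simp add: F(4)[OF s])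
    qed
  qed
qed

section \<open>The position vector of a general helix\<close>

theorem theorem3p2:
  fixes I :: "real set"
    and \<psi> T N B :: "real \<Rightarrow> real^3"
    and \<kappa> \<tau> :: "real \<Rightarrow> real"
    and u :: "real^3"
    and \<alpha> :: real
  assumes "is_interval I" and "\<exists>a\<in>I. \<exists>b\<in>I. a < b"
    and "frenet_apparatus I \<psi> T N B \<kappa> \<tau>"
    and "general_helix I T u \<alpha>"
  shows "(\<exists>K. antiderivative_on I \<kappa> K) \<and>
    (\<forall>K \<phi>. antiderivative_on I \<kappa> K \<and> \<phi> = (\<lambda>s. csc \<alpha> * K s) \<longrightarrow>
       inj_on \<phi> I \<and>
       (\<exists>R :: real^3^3.
          orthogonal_matrix R \<and>
          ((\<forall>s\<in>I. \<tau> s / \<kappa> s = cot \<alpha>) \<longrightarrow> rotation_matrix R) \<and>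
          R *v u \<in> span {axis 3 1} \<and>
          equals_scaled_integral_on I (\<lambda>s. R *v \<psi> s)
            (sin \<alpha>) (\<lambda>s. vector [cos (\<phi> s), sin (\<phi> s), cot \<alpha>]) \<and>
          equals_scaled_integral_on (\<phi> ` I) (\<lambda>t. R *v \<psi> (inv_into I \<phi> t))
            1 (\<lambda>t. ((sin \<alpha>)\<^sup>2 / \<kappa> (inv_into I \<phi> t)) *\<^sub>R vector [cos t, sin t, cot \<alpha>])))"
proof -
  have F: "norm (T s) = 1" "\<kappa> s > 0" "(\<psi> has_vector_derivative T s) (at s within I)"
    if "s \<in> I" for s
    using assms(3) that unfolding frenet_apparatus_def by auto
  have u0: "u \<noteq> 0" and ang: "\<And>s. s \<in> I \<Longrightarrow> vec_angle (T s) u = \<alpha>"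
    using assms(4) unfolding general_helix_def by auto
  obtain s0 where s0: "s0 \<in> I" using assms(2) by blast
  define U where "U = (1 / norm u) *\<^sub>R u"
  have U: "norm U = 1" using u0 by (simp add: U_def)
  have TUb: "\<bar>T s \<bullet> U\<bar> \<le> 1" if "s \<in> I" for s
    using Cauchy_Schwarz_ineq2[of "T s" U] U F(1)[OF that] by simp
  have ang': "\<alpha> = arccos (T s \<bullet> U)" if "s \<in> I" for s
    using ang[OF that] F(1)[OF that] by (simp add: vec_angle_def U_def)
  have TU: "T s \<bullet> U = cos \<alpha>" if "s \<in> I" for s
    using TUb[OF that] ang'[OF that] by (simp add: cos_arccos_abs)
  note ax = helix_axis_in_frenet_frame[OF assms(1-3) U TU]
  have "0 \<le> \<alpha>" "\<alpha> \<le> pi"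
    using TUb[OF s0] ang'[OF s0] arccos_lbound[of "T s0 \<bullet> U"] arccos_ubound[of "T s0 \<bullet> U"] by auto
  then have "sin \<alpha> \<ge> 0" by (rule sin_ge_zero)
  moreover have "sin \<alpha> \<noteq> 0" using ax(5)[OF _ s0] by blast
  ultimately have sin_pos: "sin \<alpha> > 0" by simp
  show ?thesis
  proof (intro conjI allI impI; (elim conjE)?)
    show "\<exists>K. antiderivative_on I \<kappa> K"
      using antiderivative_on_interval_exists assms(1,3) unfolding frenet_apparatus_def by blast
  next
    fix K \<phi>
    assume K: "antiderivative_on I \<kappa> K" and \<phi>: "\<phi> = (\<lambda>s. csc \<alpha> * K s)"
    have d\<phi>: "(\<phi> has_vector_derivative \<kappa> s / sin \<alpha>) (at s within I)" if "s \<in> I" for s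
    proof -
      have "(K has_vector_derivative \<kappa> s) (at s within I)"
        using K that by (simp add: antiderivative_on_def)
      then show ?thesis
        using sin_pos unfolding \<phi> csc_def has_real_derivative_iff_has_vector_derivative[symmetric]
        by (auto intro!: derivative_eq_intros)
    qed
    show inj: "inj_on \<phi> I"
      using inj_on_pos_derivative[OF assms(1) d\<phi>] F(2) sin_pos by simp
    \<comment> \<open>W is the direction of the axis that is sent to the third unit vector. It is chosen
      opposite to U if alpha is a right angle and B has negative component along U.\<close>
    obtain W where W: "norm W = 1" "\<And>s. s \<in> I \<Longrightarrow> T s \<bullet> W = cos \<alpha>" "W = U \<or> W = - U"
      "(\<forall>s\<in>I. \<tau> s / \<kappa> s = cot \<alpha>) \<longrightarrow> B s0 \<bullet> W = sin \<alpha>"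
    proof (cases "B s0 \<bullet> U = sin \<alpha>")
      case True
      then show ?thesis using that[of U] U TU by simp
    next
      case False
      then have neg: "B s0 \<bullet> U = - sin \<alpha>"
        using ax(4)[OF _ s0] by (simp add: power2_eq_iff)
      show ?thesis
      proof (cases "cos \<alpha> = 0")
        case True
        then show ?thesis using that[of "- U"] U TU neg by simp
      next
        case c: False
        have "\<tau> s0 / \<kappa> s0 \<noteq> cot \<alpha>"
        proof
          assume "\<tau> s0 / \<kappa> s0 = cot \<alpha>"
          moreover have "\<kappa> s0 * cos \<alpha> = - (\<tau> s0 * sin \<alpha>)"
            using ax(2)[OF _ s0] neg by simp
          ultimately show False
            using c sin_pos F(2)[OF s0] by (simp add: cot_def field_simps)
        qed
        then show ?thesis using that[of U] U TU s0 by blast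
      qed
    qed
    obtain R :: "real^3^3" where R: "orthogonal_matrix R" "R *v W = axis 3 1"
      "\<And>s. s \<in> I \<Longrightarrow> det R * sin \<alpha> = B s \<bullet> W"
      "\<And>s. s \<in> I \<Longrightarrow> R *v T s = sin \<alpha> *\<^sub>R vector [cos (\<phi> s), sin (\<phi> s), cot \<alpha>]"
      using helix_rotating_frame[OF assms(1-3) W(1,2) d\<phi>] by blast
    have d\<psi>: "((\<lambda>s. R *v \<psi> s) has_vector_derivative
        sin \<alpha> *\<^sub>R vector [cos (\<phi> s), sin (\<phi> s), cot \<alpha>]) (at s within I)" if "s \<in> I" for s
      unfolding R(4)[OF that, symmetric]
      by (rule bounded_linear.has_vector_derivative[OF matrix_vector_mul_bounded_linear F(3)[OF that]])
    show "\<exists>R :: real^3^3.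
          orthogonal_matrix R \<and>
          ((\<forall>s\<in>I. \<tau> s / \<kappa> s = cot \<alpha>) \<longrightarrow> rotation_matrix R) \<and>
          R *v u \<in> span {axis 3 1} \<and>
          equals_scaled_integral_on I (\<lambda>s. R *v \<psi> s)
            (sin \<alpha>) (\<lambda>s. vector [cos (\<phi> s), sin (\<phi> s), cot \<alpha>]) \<and>
          equals_scaled_integral_on (\<phi> ` I) (\<lambda>t. R *v \<psi> (inv_into I \<phi> t))
            1 (\<lambda>t. ((sin \<alpha>)\<^sup>2 / \<kappa> (inv_into I \<phi> t)) *\<^sub>R vector [cos t, sin t, cot \<alpha>])"
    proof (intro exI[of _ R] conjI impI)
      show "orthogonal_matrix R" by (rule R)
      show "rotation_matrix R" if "\<forall>s\<in>I. \<tau> s / \<kappa> s = cot \<alpha>"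
        using R(1) R(3)[OF s0] W(4) that sin_pos by (simp add: rotation_matrix_def)
      have "u = norm u *\<^sub>R W \<or> u = (- norm u) *\<^sub>R W"
        using W(3) u0 by (auto simp: U_def)
      then obtain k where "u = k *\<^sub>R W" by blast
      then have "R *v u = k *\<^sub>R axis 3 1"
        using R(2) by (simp add: matrix_vector_mult_scaleR)
      then show "R *v u \<in> span {axis 3 1}"
        by (simp add: span_base span_scale)
      show "equals_scaled_integral_on I (\<lambda>s. R *v \<psi> s)
            (sin \<alpha>) (\<lambda>s. vector [cos (\<phi> s), sin (\<phi> s), cot \<alpha>])"
        using assms(1) sin_pos d\<psi> by (intro equals_scaled_integral_onI) (auto simp: is_interval_convex)
      have "continuous_on I \<phi>"
        using d\<phi> has_vector_derivative_continuous continuous_on_eq_continuous_within by blast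
      then have "connected (\<phi> ` I)"
        using assms(1) is_interval_connected connected_continuous_image by blast
      then have conv: "convex (\<phi> ` I)" by (simp add: is_interval_connected_1[symmetric] is_interval_convex)
      show "equals_scaled_integral_on (\<phi> ` I) (\<lambda>t. R *v \<psi> (inv_into I \<phi> t))
            1 (\<lambda>t. ((sin \<alpha>)\<^sup>2 / \<kappa> (inv_into I \<phi> t)) *\<^sub>R vector [cos t, sin t, cot \<alpha>])"
      proof (rule equals_scaled_integral_onI[OF conv])
        fix t assume "t \<in> \<phi> ` I"
        then obtain s where s: "s \<in> I" "t = \<phi> s" by blast
        have inv: "inv_into I \<phi> t = s" "inv_into I \<phi> ` \<phi> ` I = I"
          using s inj by (auto simp: image_image)
        have k: "\<kappa> s / sin \<alpha> \<noteq> 0" using F(2)[OF s(1)] sin_pos by simp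
        have di: "(inv_into I \<phi> has_vector_derivative inverse (\<kappa> s / sin \<alpha>)) (at t within \<phi> ` I)"
          unfolding s(2) by (rule has_vector_derivative_inv_into[OF assms(1) inj d\<phi> s(1) k])
        have "((\<lambda>s. R *v \<psi> s) \<circ> inv_into I \<phi> has_vector_derivative
            inverse (\<kappa> s / sin \<alpha>) *\<^sub>R (sin \<alpha> *\<^sub>R vector [cos (\<phi> s), sin (\<phi> s), cot \<alpha>]))
            (at t within \<phi> ` I)"
          by (rule vector_diff_chain_within[OF di]) (use d\<psi>[OF s(1)] inv in simp)
        then show "((\<lambda>t. R *v \<psi> (inv_into I \<phi> t)) has_vector_derivative
            1 *\<^sub>R (((sin \<alpha>)\<^sup>2 / \<kappa> (inv_into I \<phi> t)) *\<^sub>R vector [cos t, sin t, cot \<alpha>]))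
            (at t within \<phi> ` I)"
          unfolding inv(1) s(2)[symmetric] by (simp add: o_def power2_eq_square)
      qed simp
    qed
  qed
qed

end
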